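(* Let $P(x)=x^d+\dots+a_1x+a_0\in\mathbb{Z}[x]$ be a monic polynomial with distinct roots $\alpha_1,\dots,\alpha_d$, and suppose that exactly $m$ of the roots satisfy $|\alpha_j|>1$. Then $$\limsup_{n\to\infty}|\Delta(P_n)|^{\frac1n}\ \ge\ M(P)^d\,|a_0|^{d-m-1}\ \ge\ M(P)^{d-1}.$$
   Context: $M(P)=\prod_{j=1}^d\max\{1,|\alpha_j|\}$ is the Mahler measure of the monic polynomial $P$. For $n\ge1$, $P_n(x):=\prod_{j=1}^d(x-\alpha_j^n)\in\mathbb{Z}[x]$ and $\Delta(P_n)=\prod_{1\le j<k\le d}(\alpha_j^n-\alpha_k^n)^2$ is its discriminant.
   Formalization: The second inequality is asserted only if a_0 ≠ 0 or m = d-1; otherwise it fails (P = x(x-1): the middle term is 0, the right side 1). The first inequality and limsup ≥ M(P)^{d-1} are proved for all P. *)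

theory Defs
  imports
    "HOL-Analysis.Analysis"
    "Berlekamp_Zassenhaus.Mahler_Measure"
begin

definition power_poly :: "(nat \<Rightarrow> complex) \<Rightarrow> nat \<Rightarrow> nat \<Rightarrow> complex poly" where
  "power_poly \<alpha> d n = (\<Prod>j = 1..d. [:- (\<alpha> j ^ n), 1:])"

text \<open>The roots are taken with multiplicity, from the list \<^term>\<open>complex_roots_complex p\<close>. The
  order of that list is an arbitrary choice, on which the value does not depend; see
  \<open>discriminant_prod_linear\<close>. For monic polynomials the leading factor is 1.\<close>

definition discriminant :: "complex poly \<Rightarrow> complex" where
  "discriminant p = lead_coeff p ^ (2 * degree p - 2) *
     (\<Prod>k < degree p. \<Prod>j < k.
        (complex_roots_complex p ! j - complex_roots_complex p ! k)\<^sup>2)"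

primrec list_disc :: "complex list \<Rightarrow> complex" where
  "list_disc [] = 1"
| "list_disc (x # xs) = (\<Prod>y \<in># mset xs. (x - y)\<^sup>2) * list_disc xs"

lemma list_disc_nth:
  "list_disc xs = (\<Prod>k < length xs. \<Prod>j < k. (xs ! j - xs ! k)\<^sup>2)"
proof (induction xs)
  case (Cons x xs)
  have "(\<Prod>y \<in># mset xs. (x - y)\<^sup>2) = (\<Prod>k < length xs. (x - xs ! k)\<^sup>2)"
    by (simp add: prod_mset_prod_list prod.list_conv_set_nth atLeast0LessThan flip: mset_map)
  then show ?case
    using Cons.IH by (simp add: prod.lessThan_Suc_shift prod.distrib del: prod.lessThan_Suc)
qed simp

lemma list_disc_middle:
  "list_disc (us @ x # vs) = (\<Prod>y \<in># mset (us @ vs). (x - y)\<^sup>2) * list_disc (us @ vs)"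
  by (induction us) (simp_all add: power2_commute[of x] mult_ac)

lemma list_disc_cong_mset:
  "mset xs = mset ys \<Longrightarrow> list_disc xs = list_disc ys"
proof (induction xs arbitrary: ys)
  case (Cons x xs)
  then have "x \<in> set ys"
    by (metis list.set_intros(1) mset_eq_setD)
  then obtain us vs where ys: "ys = us @ x # vs"
    by (meson split_list)
  then have "mset xs = mset (us @ vs)"
    using Cons.prems by simp
  then show ?case
    using Cons.IH[of "us @ vs"] ys list_disc_middle by simp
qed simp

lemma discriminant_prod_linear:
  fixes \<beta> :: "nat \<Rightarrow> complex"
  shows "discriminant (\<Prod>j = 1..d. [:- \<beta> j, 1:]) =
     (\<Prod>k = 1..d. \<Prod>j = 1..<k. (\<beta> j - \<beta> k)\<^sup>2)"
proof -
  define p where "p = (\<Prod>j = 1..d. [:- \<beta> j, 1:])"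
  define bs where "bs = map \<beta> [1..<Suc d]"
  have p_bs: "p = (\<Prod>a\<leftarrow>bs. [:- a, 1:])"
    unfolding p_def bs_def
    by (simp add: prod.distinct_set_conv_list[symmetric] atLeastLessThanSuc_atLeastAtMost comp_def
          del: upt_Suc)
  have lc: "lead_coeff p = 1"
    unfolding p_def by (rule monic_prod) simp
  have "(\<Prod>a\<leftarrow>complex_roots_complex p. [:- a, 1:]) = p"
    using complex_roots(1)[of p] lc by simp
  then have eq: "mset (complex_roots_complex p) = mset bs"
    by (intro reconstruct_poly_monic_defines_mset) (simp add: p_bs)
  then have deg: "degree p = d"
    using complex_roots(2)[of p] mset_eq_length[OF eq] by (simp add: bs_def del: upt_Suc)
  have "discriminant p = list_disc bs"
    unfolding list_disc_cong_mset[OF eq, symmetric]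
    by (simp add: list_disc_nth discriminant_def lc)
  also have "\<dots> = (\<Prod>k < d. \<Prod>j < k. (\<beta> (Suc j) - \<beta> (Suc k))\<^sup>2)"
    unfolding list_disc_nth by (auto simp: bs_def simp del: upt_Suc intro!: prod.cong)
  also have "\<dots> = (\<Prod>k = 1..d. \<Prod>j = 1..<k. (\<beta> j - \<beta> k)\<^sup>2)"
  proof -
    have "(\<Prod>j < k. (\<beta> (Suc j) - \<beta> (Suc k))\<^sup>2) = (\<Prod>j = 1..<Suc k. (\<beta> j - \<beta> (Suc k))\<^sup>2)" for k
      by (simp add: prod.shift_bounds_Suc_ivl lessThan_atLeast0 del: prod.op_ivl_Suc)
    then show ?thesis
      by (simp add: prod.shift_bounds_Suc_ivl lessThan_atLeast0 del: prod.op_ivl_Suc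
            flip: atLeastLessThanSuc_atLeastAtMost)
  qed
  finally show ?thesis
    unfolding p_def .
qed

end

theory Submission
  imports Defs
begin

text \<open>Let \<open>\<alpha>\<^sub>j = \<bar>\<alpha>\<^sub>j\<bar> u\<^sub>j\<close>. By Dirichlet's theorem there are infinitely many \<open>n\<close> for which all
  \<open>u\<^sub>j\<^sup>n\<close> are close to 1; at the exponent \<open>n + 1\<close> the differences \<open>\<alpha>\<^sub>j\<^sup>n\<^sup>+\<^sup>1 - \<alpha>\<^sub>k\<^sup>n\<^sup>+\<^sup>1\<close> of roots of equal
  modulus do not cancel, so the limsup is at least \<open>L\<close>, the product of
  \<open>max(\<bar>\<alpha>\<^sub>j\<bar>, \<bar>\<alpha>\<^sub>k\<bar>)\<^sup>2\<close> over \<open>j < k\<close>. Bounding each factor below by \<open>\<bar>\<alpha>\<^sub>j \<alpha>\<^sub>k\<bar>\<close> if both roots lie on the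
  same side of the threshold 1, and by the square of the larger modulus otherwise, gives exactly
  \<open>M(P)\<^sup>d \<bar>a\<^sub>0\<bar>\<^sup>d\<^sup>-\<^sup>m\<^sup>-\<^sup>1\<close>. If 0 is a root, this is useless for \<open>m < d - 1\<close>; using the square of the
  larger modulus for the pairs containing that root as well, the bound becomes
  \<open>L \<ge> M(P)\<^sup>d\<^sup>-\<^sup>1 \<bar>Q(0)\<bar>\<^sup>d\<^sup>-\<^sup>m\<close> with \<open>P = x Q\<close>, where \<open>Q(0)\<close> is a nonzero integer.\<close>

section \<open>Simultaneous approximation and differences of powers\<close>

text \<open>Simultaneous Dirichlet approximation of the arguments, measured in full turns, brings
  all the powers near 1 at a common exponent.\<close>

lemma frequently_powers_near_one:
  fixes u :: "nat \<Rightarrow> complex"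
  assumes "\<And>i. i < d \<Longrightarrow> cmod (u i) = 1" and "e > 0"
  shows "\<exists>\<^sub>F n in sequentially. \<forall>i<d. cmod (u i ^ n - 1) < e"
  unfolding frequently_sequentially
proof
  fix K :: nat
  \<comment> \<open>Dirichlet's theorem only gives \<open>q > 0\<close>; building
    \<open>Suc K\<close> into the angles forces the exponent \<open>nat q * Suc K\<close> past
    \<open>K\<close>.\<close>
  define \<theta> where "\<theta> i = Suc K * Arg (u i) / (2 * pi)" for i
  obtain N :: nat where "2 * pi / e < N"
    using reals_Archimedean2 by blast
  moreover have "2 * pi / e > 0"
    using \<open>e > 0\<close> by simp
  ultimately have "N > 0"
    by (intro Nat.gr0I) auto
  with \<open>2 * pi / e < N\<close> have N: "N > 0" "2 * pi / N < e"
    using \<open>e > 0\<close> by (auto simp: field_simps)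
  obtain q p where q: "0 < q" and p: "\<And>i. i < d \<Longrightarrow> \<bar>of_int q * \<theta> i - of_int (p i)\<bar> < 1 / N"
    using Dirichlet_approx_simult[OF N(1), of d \<theta>] by metis
  define n where "n = nat q * Suc K"
  have "cmod (u i ^ n - 1) < e" if "i < d" for i
  proof -
    define t where "t = of_int q * \<theta> i - of_int (p i)"
    have ui: "u i = cis (Arg (u i))"
      using assms(1)[OF that] rcis_cmod_Arg[of "u i"] by (simp add: rcis_def)
    have "u i ^ n = cis (n * Arg (u i))"
      using ui by (metis Complex.DeMoivre)
    also have "n * Arg (u i) = 2 * pi * t + 2 * pi * of_int (p i)"
      using q by (simp add: n_def t_def \<theta>_def field_simps)
    also have "cis \<dots> = cis (2 * pi * t)"
      by (simp flip: cis_mult)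
    also have "\<dots> = exp (\<i> * of_real (2 * pi * t))"
      by (rule cis_conv_exp)
    finally have "cmod (u i ^ n - 1) = 2 * \<bar>sin (2 * pi * t / 2)\<bar>"
      by (simp only: dist_exp_i_1)
    \<comment> \<open>The chord is at most as long as the arc.\<close>
    also have "\<dots> \<le> 2 * pi * \<bar>t\<bar>"
      using abs_sin_x_le_abs_x[of "2 * pi * t / 2"] by (simp add: abs_mult)
    also have "\<dots> \<le> 2 * pi * (1 / N)"
      using p[OF that] by (intro mult_left_mono) (auto simp: t_def)
    finally show ?thesis
      using N by simp
  qed
  moreover have "1 * Suc K \<le> n"
    unfolding n_def using q by (intro mult_le_mono1) simp
  then have "n \<ge> K"
    by simp
  ultimately show "\<exists>n\<ge>K. \<forall>i<d. cmod (u i ^ n - 1) < e"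
    by blast
qed

text \<open>The ratio of the norms is below 1, so its powers with positive exponent never exceed it;
  the reverse triangle inequality does the rest.\<close>

lemma power_diff_lower_bound_less:
  fixes x y :: "'a :: real_normed_field"
  assumes "norm y < norm x" and "n > 0"
  shows "(1 - norm y / norm x) * norm x ^ n \<le> norm (x ^ n - y ^ n)"
proof -
  have x: "norm x > 0"
    using assms(1) norm_ge_zero[of y] by linarith
  have "(norm y / norm x) ^ n \<le> (norm y / norm x) ^ 1"
    using assms x by (intro power_decreasing) auto
  then have "norm y ^ n \<le> norm y / norm x * norm x ^ n"
    using x by (simp add: power_divide field_simps)
  moreover have "norm x ^ n - norm y ^ n \<le> norm (x ^ n - y ^ n)"
    using norm_triangle_ineq2[of "x ^ n" "y ^ n"] by (simp add: norm_power)
  ultimately show ?thesis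
    by (simp add: algebra_simps)
qed

text \<open>For equal moduli the difference is \<open>cmod x ^ n\<close> times
  \<open>u ^ n - v ^ n\<close>. Closeness to \<open>u\<close> and \<open>v\<close>, rather than to
  1, keeps the second factor near \<open>u - v\<close>, which is nonzero.\<close>

lemma power_diff_lower_bound:
  fixes x y u v :: complex
  assumes "x \<noteq> y" and x: "x = of_real (cmod x) * u" and y: "y = of_real (cmod y) * v"
  obtains c e where "c > 0" and "e > 0" and
    "\<And>n. n > 0 \<Longrightarrow> cmod (u ^ n - u) < e \<Longrightarrow> cmod (v ^ n - v) < e \<Longrightarrow>
       c * max (cmod x) (cmod y) ^ n \<le> cmod (x ^ n - y ^ n)"
proof -
  consider "cmod x < cmod y" | "cmod y < cmod x" | "cmod x = cmod y"
    by linarith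
  then show thesis
  proof cases
    case 1
    then show thesis
      using power_diff_lower_bound_less[OF 1] le_less_trans[OF norm_ge_zero 1]
      by (intro that[of "1 - cmod x / cmod y" 1]) (auto simp: norm_minus_commute max_def)
  next
    case 2
    then show thesis
      using power_diff_lower_bound_less[OF 2] le_less_trans[OF norm_ge_zero 2]
      by (intro that[of "1 - cmod y / cmod x" 1]) (auto simp: max_def)
  next
    case 3
    \<comment> \<open>The two deviations use up at most two thirds of \<open>cmod (u - v)\<close>,
      leaving \<open>c\<close>.\<close>
    define c where "c = cmod (u - v) / 3"
    have "u \<noteq> v"
      using assms 3 by metis
    then have "c > 0"
      by (simp add: c_def)
    moreover have "c * max (cmod x) (cmod y) ^ n \<le> cmod (x ^ n - y ^ n)"
      if "cmod (u ^ n - u) < c" "cmod (v ^ n - v) < c" for n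
    proof -
      have "cmod (u - v) \<le> cmod (u ^ n - v ^ n) + cmod (u ^ n - u) + cmod (v ^ n - v)"
        by norm
      then have "c \<le> cmod (u ^ n - v ^ n)"
        using that by (simp add: c_def)
      moreover have "x ^ n - y ^ n = of_real (cmod x ^ n) * (u ^ n - v ^ n)"
        by (subst x, subst y) (simp add: 3 power_mult_distrib right_diff_distrib)
      ultimately show ?thesis
        by (simp add: 3 norm_mult norm_power mult.commute[of c] mult_left_mono)
    qed
    ultimately show thesis
      using that by blast
  qed
qed

lemma frequently_prod_power_diff_ge:
  fixes \<alpha> :: "nat \<Rightarrow> complex"
  assumes "inj_on \<alpha> {1..d}"
  obtains C where "C > 0" and
    "\<exists>\<^sub>F n in sequentially. C * (\<Prod>k = 1..d. \<Prod>j = 1..<k. (max (cmod (\<alpha> j)) (cmod (\<alpha> k)))\<^sup>2) ^ n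
       \<le> cmod (\<Prod>k = 1..d. \<Prod>j = 1..<k. (\<alpha> j ^ n - \<alpha> k ^ n)\<^sup>2)"
proof -
  \<comment> \<open>A zero root gets direction 1: this keeps \<open>u j\<close> of modulus 1, and
    the polar form still holds since the modulus of the root vanishes.\<close>
  define u where "u j = (if \<alpha> j = 0 then 1 else sgn (\<alpha> j))" for j
  have u1: "cmod (u j) = 1" for j
    by (simp add: u_def norm_sgn)
  have \<alpha>: "\<alpha> j = of_real (cmod (\<alpha> j)) * u j" for j
    by (simp add: u_def sgn_eq)
  define I where "I = (SIGMA k:{1..d}. {1..<k})"
  have "finite I"
    by (simp add: I_def)
  have "\<exists>c e. c > 0 \<and> e > 0 \<and>
      (\<forall>n>0. cmod (u j ^ n - u j) < e \<longrightarrow> cmod (u k ^ n - u k) < e \<longrightarrow>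
        c * max (cmod (\<alpha> j)) (cmod (\<alpha> k)) ^ n \<le> cmod (\<alpha> j ^ n - \<alpha> k ^ n))"
    if "(k, j) \<in> I" for k j
  proof -
    have "\<alpha> j \<noteq> \<alpha> k"
      using that assms by (auto simp: I_def dest: inj_onD)
    then show ?thesis
      using power_diff_lower_bound[OF _ \<alpha> \<alpha>] by metis
  qed
  then obtain c e where ce: "\<And>k j. (k, j) \<in> I \<Longrightarrow> c k j > 0 \<and> e k j > 0 \<and>
      (\<forall>n>0. cmod (u j ^ n - u j) < e k j \<longrightarrow> cmod (u k ^ n - u k) < e k j \<longrightarrow>
        c k j * max (cmod (\<alpha> j)) (cmod (\<alpha> k)) ^ n \<le> cmod (\<alpha> j ^ n - \<alpha> k ^ n))"
    by metis
  \<comment> \<open>The inserted 1 keeps the minimum meaningful when there are no pairs.\<close>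
  define E where "E = Min (insert (1::real) ((\<lambda>(k, j). e k j) ` I))"
  have E: "E > 0" "\<And>k j. (k, j) \<in> I \<Longrightarrow> E \<le> e k j"
    using \<open>finite I\<close> ce by (force simp: E_def intro!: Min_le)+
  define C where "C = (\<Prod>k = 1..d. \<Prod>j = 1..<k. (c k j)\<^sup>2)"
  have "C > 0"
    unfolding C_def by (intro prod_pos zero_less_power ce[THEN conjunct1]) (auto simp: I_def)
  have bound: "C * (\<Prod>k = 1..d. \<Prod>j = 1..<k. (max (cmod (\<alpha> j)) (cmod (\<alpha> k)))\<^sup>2) ^ n
       \<le> cmod (\<Prod>k = 1..d. \<Prod>j = 1..<k. (\<alpha> j ^ n - \<alpha> k ^ n)\<^sup>2)"
    if "n > 0" and near: "\<And>j. j \<le> d \<Longrightarrow> cmod (u j ^ n - u j) < E" for n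
  proof -
    have "C * (\<Prod>k = 1..d. \<Prod>j = 1..<k. (max (cmod (\<alpha> j)) (cmod (\<alpha> k)))\<^sup>2) ^ n =
        (\<Prod>k = 1..d. \<Prod>j = 1..<k. (c k j * max (cmod (\<alpha> j)) (cmod (\<alpha> k)) ^ n)\<^sup>2)"
      by (simp add: C_def prod_power_distrib prod.distrib power_mult_distrib mult.commute
          flip: power_mult)
    also have "\<dots> \<le> (\<Prod>k = 1..d. \<Prod>j = 1..<k. (cmod (\<alpha> j ^ n - \<alpha> k ^ n))\<^sup>2)"
    proof (intro prod_mono conjI prod_nonneg power_mono zero_le_power2)
      fix k j assume "k \<in> {1..d}" "j \<in> {1..<k}"
      then have kj: "(k, j) \<in> I" and "j \<le> d" "k \<le> d"
        by (auto simp: I_def)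
      then have "cmod (u j ^ n - u j) < e k j" "cmod (u k ^ n - u k) < e k j"
        using near E(2)[OF kj] by (meson less_le_trans)+
      then show "c k j * max (cmod (\<alpha> j)) (cmod (\<alpha> k)) ^ n \<le> cmod (\<alpha> j ^ n - \<alpha> k ^ n)"
        using ce[OF kj] \<open>n > 0\<close> by blast
      show "0 \<le> c k j * max (cmod (\<alpha> j)) (cmod (\<alpha> k)) ^ n"
        using ce[OF kj] by (simp add: le_max_iff_disj)
    qed
    also have "\<dots> = cmod (\<Prod>k = 1..d. \<Prod>j = 1..<k. (\<alpha> j ^ n - \<alpha> k ^ n)\<^sup>2)"
      by (simp add: norm_power flip: prod_norm)
    finally show ?thesis .
  qed
  show thesis
  proof (rule that[OF \<open>C > 0\<close>], unfold frequently_sequentially, rule allI)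
    fix K :: nat
    \<comment> \<open>\<open>Suc d\<close> because the approximation lemma indexes from 0, while the
      roots are numbered from 1 to \<open>d\<close>.\<close>
    obtain n where n: "n \<ge> K" "\<forall>i<Suc d. cmod (u i ^ n - 1) < E"
      using frequently_powers_near_one[of "Suc d" u E] u1 E(1)
      unfolding frequently_sequentially by meson
    \<comment> \<open>Multiplication by the unit \<open>u j\<close> moves the target from 1 to
      \<open>u j\<close>; the shifted exponent is also positive, as \<open>bound\<close>
      demands.\<close>
    have "cmod (u j ^ Suc n - u j) < E" if "j \<le> d" for j
    proof -
      have "u j ^ Suc n - u j = u j * (u j ^ n - 1)"
        by (simp add: algebra_simps)
      then show ?thesis
        using n(2) that u1 by (simp only: norm_mult) simp
    qed
    with n(1) bound[of "Suc n"]
    show "\<exists>n\<ge>K. C * (\<Prod>k = 1..d. \<Prod>j = 1..<k. (max (cmod (\<alpha> j)) (cmod (\<alpha> k)))\<^sup>2) ^ n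
       \<le> cmod (\<Prod>k = 1..d. \<Prod>j = 1..<k. (\<alpha> j ^ n - \<alpha> k ^ n)\<^sup>2)"
      by (intro exI[of _ "Suc n"]) auto
  qed
qed

section \<open>From frequent lower bounds to the limsup\<close>

text \<open>The constant is harmless because \<open>root n C\<close> tends to 1, so
  \<open>root n C * L\<close> eventually exceeds any \<open>y < L\<close>.\<close>

lemma limsup_root_ge:
  fixes f :: "nat \<Rightarrow> real"
  assumes "C > 0" and "L \<ge> 0" and "\<exists>\<^sub>F n in sequentially. C * L ^ n \<le> f n"
  shows "ereal L \<le> limsup (\<lambda>n. ereal (root n (f n)))"
proof (rule ccontr)
  assume "\<not> ?thesis"
  then obtain y where y: "limsup (\<lambda>n. ereal (root n (f n))) < ereal y" "y < L"
    using ereal_dense3 [of _ "ereal L"] by (meson ereal_dense2 ereal_less_eq(3) less_ereal.simps(1) not_le)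
  have "(\<lambda>n. root n C * L) \<longlonglongrightarrow> 1 * L"
    by (intro tendsto_intros LIMSEQ_root_const assms(1))
  then have "\<forall>\<^sub>F n in sequentially. y < root n C * L"
    using y(2) by (simp add: order_tendstoD(1))
  moreover have "\<forall>\<^sub>F n in sequentially. root n (f n) < y"
    using Limsup_lessD[OF y(1)] by simp
  \<comment> \<open>The index 0 must be excluded, since \<open>root 0\<close> is constantly
    0.\<close>
  ultimately have "\<forall>\<^sub>F n in sequentially. \<not> C * L ^ n \<le> f n"
    using eventually_gt_at_top[of 0]
  proof eventually_elim
    case (elim n)
    then have "root n (f n) < root n (C * L ^ n)"
      using \<open>L \<ge> 0\<close> by (simp add: real_root_mult real_root_power_cancel)
    then show ?case
      using elim(3) by simp
  qed
  then show False
    using assms(3) by (simp add: frequently_def)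
qed

section \<open>Lower bounds for the product of maxima over pairs\<close>

text \<open>Both sides run once over all ordered pairs of distinct indices. This regroups a bound
  made pair by pair into one power of each entry.\<close>

lemma prod_triangle_symmetric:
  fixes f :: "nat \<Rightarrow> nat \<Rightarrow> 'a :: comm_monoid_mult"
  shows "(\<Prod>k = 1..d. \<Prod>j = 1..<k. f j k * f k j) = (\<Prod>k = 1..d. \<Prod>j \<in> {1..d} - {k}. f k j)"
proof (induction d)
  case (Suc d)
  have "(\<Prod>k = 1..d. \<Prod>j \<in> {1..Suc d} - {k}. f k j) =
      (\<Prod>k = 1..d. f k (Suc d) * (\<Prod>j \<in> {1..d} - {k}. f k j))"
  proof (intro prod.cong refl)
    fix k assume "k \<in> {1..d}"
    then have "{1..Suc d} - {k} = insert (Suc d) ({1..d} - {k})"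
      by auto
    then show "(\<Prod>j \<in> {1..Suc d} - {k}. f k j) = f k (Suc d) * (\<Prod>j \<in> {1..d} - {k}. f k j)"
      by simp
  qed
  moreover have "{1..Suc d} - {Suc d} = {1..d}"
    by auto
  ultimately show ?case
    using Suc by (simp add: prod.distrib atLeastLessThanSuc_atLeastAtMost mult_ac del: prod.op_ivl_Suc)
qed simp

text \<open>The square of \<open>max(a\<^sub>j, a\<^sub>k)\<close> is bounded below by \<open>a\<^sub>j a\<^sub>k\<close> for indices of equal rank, and by
  the square of the entry of higher rank otherwise; \<open>rank_exponent r k j\<close> is the exponent of
  \<open>a\<^sub>k\<close> in the bound for the pair \<open>j, k\<close>.\<close>

definition rank_exponent :: "(nat \<Rightarrow> nat) \<Rightarrow> nat \<Rightarrow> nat \<Rightarrow> nat" where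
  "rank_exponent r k j = (if r j = r k then 1 else if r j < r k then 2 else 0)"

lemma prod_max_ge_rank:
  fixes a :: "nat \<Rightarrow> real"
  assumes a: "\<And>j. a j \<ge> 0" and r: "\<And>j k. r j < r k \<Longrightarrow> a j \<le> a k"
  shows "(\<Prod>k = 1..d. a k ^ (\<Sum>j \<in> {1..d} - {k}. rank_exponent r k j))
           \<le> (\<Prod>k = 1..d. \<Prod>j = 1..<k. (max (a j) (a k))\<^sup>2)"
proof -
  have "(\<Prod>k = 1..d. a k ^ (\<Sum>j \<in> {1..d} - {k}. rank_exponent r k j)) =
      (\<Prod>k = 1..d. \<Prod>j = 1..<k. a j ^ rank_exponent r j k * a k ^ rank_exponent r k j)"
    by (simp only: power_sum prod_triangle_symmetric[of "\<lambda>k j. a k ^ rank_exponent r k j"])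
  also have "\<dots> \<le> (\<Prod>k = 1..d. \<Prod>j = 1..<k. (max (a j) (a k))\<^sup>2)"
  proof (intro prod_mono conjI prod_nonneg)
    fix k j
    consider "r j = r k" | "r j < r k" | "r k < r j"
      by linarith
    then show "a j ^ rank_exponent r j k * a k ^ rank_exponent r k j \<le> (max (a j) (a k))\<^sup>2"
      using a[of j] a[of k] r[of j k] r[of k j]
      by cases (auto simp: rank_exponent_def power2_eq_square max_def mult_mono)
  qed (use a in auto)
  finally show ?thesis .
qed

lemma sum_rank_exponent:
  assumes "finite I"
  shows "(\<Sum>j \<in> I - {k}. rank_exponent r k j) =
    card {j \<in> I - {k}. r j = r k} + 2 * card {j \<in> I. r j < r k}"
proof -
  have "(\<Sum>j \<in> I - {k}. rank_exponent r k j) =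
      (\<Sum>j \<in> I - {k}. (if r j = r k then 1 else 0) + (if r j < r k then 2 else 0))"
    by (intro sum.cong) (auto simp: rank_exponent_def)
  also have "\<dots> = card {j \<in> I - {k}. r j = r k} + 2 * card {j \<in> I - {k}. r j < r k}"
    using assms by (simp add: sum.distrib flip: sum.inter_filter)
  also have "{j \<in> I - {k}. r j < r k} = {j \<in> I. r j < r k}"
    by auto
  finally show ?thesis .
qed

text \<open>Two ranks, split at 1: an index in \<open>S\<close> has \<open>card S - 1\<close> peers
  and \<open>card T\<close> indices below it, one in \<open>T\<close> has \<open>card T - 1\<close>
  peers and none below.\<close>

lemma prod_max_ge:
  fixes a :: "nat \<Rightarrow> real"
  assumes a: "\<And>j. a j \<ge> 0"
    and S: "S = {j \<in> {1..d}. a j > 1}" and T: "T = {j \<in> {1..d}. a j \<le> 1}"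
  shows "prod a S ^ (card S - 1 + 2 * card T) * prod a T ^ (card T - 1)
           \<le> (\<Prod>k = 1..d. \<Prod>j = 1..<k. (max (a j) (a k))\<^sup>2)"
proof -
  define r where "r j = (if a j > 1 then 1 else 0 :: nat)" for j
  define w where "w k = (\<Sum>j \<in> {1..d} - {k}. rank_exponent r k j)" for k
  have w: "w k = card {j \<in> {1..d} - {k}. r j = r k} + 2 * card {j \<in> {1..d}. r j < r k}" for k
    unfolding w_def by (rule sum_rank_exponent) simp
  have wS: "w k = card S - 1 + 2 * card T" if "k \<in> S" for k
  proof -
    have "{j \<in> {1..d} - {k}. r j = r k} = S - {k}" "{j \<in> {1..d}. r j < r k} = T"
      using that by (auto simp: S T r_def)
    then show ?thesis
      using that by (simp add: w)
  qed
  have wT: "w k = card T - 1" if "k \<in> T" for k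
  proof -
    have "{j \<in> {1..d} - {k}. r j = r k} = T - {k}" "{j \<in> {1..d}. r j < r k} = {}"
      using that by (auto simp: T r_def)
    then show ?thesis
      using that by (simp add: w)
  qed
  have "{1..d} = S \<union> T" "S \<inter> T = {}" "finite S" "finite T"
    by (auto simp: S T)
  then have "(\<Prod>k = 1..d. a k ^ w k) = (\<Prod>k \<in> S. a k ^ w k) * (\<Prod>k \<in> T. a k ^ w k)"
    by (simp add: prod.union_disjoint)
  also have "\<dots> = prod a S ^ (card S - 1 + 2 * card T) * prod a T ^ (card T - 1)"
    by (simp add: wS wT prod_power_distrib)
  finally have eq: "(\<Prod>k = 1..d. a k ^ w k) =
    prod a S ^ (card S - 1 + 2 * card T) * prod a T ^ (card T - 1)" .
  show ?thesis
    unfolding eq[symmetric] w_def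
    using a by (intro prod_max_ge_rank) (auto simp: r_def split: if_splits)
qed

text \<open>A third, lowest rank is reserved for \<open>z\<close>. Every other index of
  \<open>T\<close> then has \<open>card T - 2\<close> peers and earns 2 from \<open>z\<close>, hence
  exponent \<open>card T\<close>.\<close>

lemma prod_max_ge_zero:
  fixes a :: "nat \<Rightarrow> real"
  assumes a: "\<And>j. a j \<ge> 0"
    and S: "S = {j \<in> {1..d}. a j > 1}" and T: "T = {j \<in> {1..d}. a j \<le> 1}"
    and z: "z \<in> {1..d}" "a z = 0"
  shows "prod a S ^ (card S - 1 + 2 * card T) * prod a (T - {z}) ^ card T
           \<le> (\<Prod>k = 1..d. \<Prod>j = 1..<k. (max (a j) (a k))\<^sup>2)"
proof -
  define r where "r j = (if a j > 1 then 2 else if j = z then 0 else 1 :: nat)" for j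
  define w where "w k = (\<Sum>j \<in> {1..d} - {k}. rank_exponent r k j)" for k
  have w: "w k = card {j \<in> {1..d} - {k}. r j = r k} + 2 * card {j \<in> {1..d}. r j < r k}" for k
    unfolding w_def by (rule sum_rank_exponent) simp
  have wS: "w k = card S - 1 + 2 * card T" if "k \<in> S" for k
  proof -
    have "{j \<in> {1..d} - {k}. r j = r k} = S - {k}" "{j \<in> {1..d}. r j < r k} = T"
      using that by (auto simp: S T r_def split: if_splits)
    then show ?thesis
      using that by (simp add: w)
  qed
  have wT: "w k = card T" if "k \<in> T - {z}" for k
  proof -
    have "{j \<in> {1..d} - {k}. r j = r k} = T - {z} - {k}" "{j \<in> {1..d}. r j < r k} = {z}"
      using that z by (auto simp: T r_def split: if_splits)
    \<comment> \<open>Guards the truncated subtraction in \<open>card T - 2 + 2\<close>.\<close>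
    moreover have "card T > 1"
      using card_mono[of T "{k, z}"] that z by (simp add: T)
    ultimately show ?thesis
      using that z by (simp add: w T card_Diff_singleton)
  qed
  \<comment> \<open>With exponent 0 the vanishing entry contributes the factor 1.\<close>
  have wz: "w z = 0"
  proof -
    have "{j \<in> {1..d} - {z}. r j = r z} = {}" "{j \<in> {1..d}. r j < r z} = {}"
      using z by (auto simp: r_def)
    then show ?thesis
      by (simp only: w) simp
  qed
  have "{1..d} = insert z (S \<union> (T - {z}))" "S \<inter> (T - {z}) = {}" "finite S" "finite T" "z \<notin> S"
    using z by (auto simp: S T)
  then have "(\<Prod>k = 1..d. a k ^ w k) = (\<Prod>k \<in> S. a k ^ w k) * (\<Prod>k \<in> T - {z}. a k ^ w k)"
    using wz by (simp add: prod.union_disjoint)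
  also have "\<dots> = prod a S ^ (card S - 1 + 2 * card T) * prod a (T - {z}) ^ card T"
    by (simp add: wS wT prod_power_distrib)
  finally have eq: "(\<Prod>k = 1..d. a k ^ w k) =
    prod a S ^ (card S - 1 + 2 * card T) * prod a (T - {z}) ^ card T" .
  have rank: "a j \<le> a k" if "r j < r k" for j k
    using that a[of j] a[of k] z by (auto simp: r_def split: if_splits)
  show ?thesis
    unfolding eq[symmetric] w_def using a rank by (rule prod_max_ge_rank)
qed

section \<open>Mahler measure and constant coefficient in terms of the roots\<close>

lemma mahler_measure_prod_linear:
  fixes \<alpha> :: "nat \<Rightarrow> complex"
  assumes "map_poly of_int P = (\<Prod>j = 1..d. [:- \<alpha> j, 1:])"
  shows "mahler_measure P = (\<Prod>j \<in> {j \<in> {1..d}. cmod (\<alpha> j) > 1}. cmod (\<alpha> j))"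
proof -
  define p where "p = (\<Prod>j = 1..d. [:- \<alpha> j, 1:])"
  define bs where "bs = map \<alpha> [1..<Suc d]"
  have p_bs: "p = (\<Prod>a\<leftarrow>bs. [:- a, 1:])"
    unfolding p_def bs_def
    by (simp add: prod.distinct_set_conv_list[symmetric] atLeastLessThanSuc_atLeastAtMost comp_def
          del: upt_Suc)
  have lc: "lead_coeff p = 1"
    unfolding p_def by (rule monic_prod) simp
  have "(\<Prod>a\<leftarrow>complex_roots_complex p. [:- a, 1:]) = p"
    using complex_roots(1)[of p] lc by simp
  then have eq: "mset (complex_roots_complex p) = mset bs"
    by (intro reconstruct_poly_monic_defines_mset) (simp add: p_bs)
  have "mahler_measure P = (\<Prod>a\<leftarrow>complex_roots_complex p. max 1 (cmod a))"
    using lc assms by (simp add: mahler_measure_def mahler_measure_poly_def p_def)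
  also have "\<dots> = (\<Prod>a\<leftarrow>bs. max 1 (cmod a))"
    using arg_cong[OF eq, of "\<lambda>A. \<Prod>a\<in>#A. max 1 (cmod a)"]
    by (simp add: prod_mset_prod_list flip: mset_map)
  also have "\<dots> = (\<Prod>j = 1..d. max 1 (cmod (\<alpha> j)))"
    unfolding bs_def
    by (simp add: prod.distinct_set_conv_list[symmetric] atLeastLessThanSuc_atLeastAtMost comp_def
          del: upt_Suc)
  also have "\<dots> = (\<Prod>j \<in> {j \<in> {1..d}. cmod (\<alpha> j) > 1}. max 1 (cmod (\<alpha> j)))"
    by (intro prod.mono_neutral_right) auto
  also have "\<dots> = (\<Prod>j \<in> {j \<in> {1..d}. cmod (\<alpha> j) > 1}. cmod (\<alpha> j))"
    by (intro prod.cong) auto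
  finally show ?thesis .
qed

text \<open>The index set is arbitrary so that this applies both to \<open>P\<close> and to its
  cofactor after division by x.\<close>

lemma abs_coeff_0_prod_linear:
  fixes \<alpha> :: "'i \<Rightarrow> complex"
  assumes "map_poly of_int P = (\<Prod>j \<in> I. [:- \<alpha> j, 1:])"
  shows "real_of_int \<bar>poly.coeff P 0\<bar> = (\<Prod>j \<in> I. cmod (\<alpha> j))"
proof -
  have "of_int (poly.coeff P 0) = poly (map_poly of_int P :: complex poly) 0"
    by (simp add: poly_0_coeff_0)
  also have "\<dots> = (\<Prod>j \<in> I. - \<alpha> j)"
    by (simp add: assms poly_prod)
  finally have "cmod (of_int (poly.coeff P 0)) = (\<Prod>j \<in> I. cmod (\<alpha> j))"
    by (simp flip: prod_norm)
  then show ?thesis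
    by simp
qed

text \<open>The product is the absolute value of \<open>Q(0)\<close> for the integer polynomial
  \<open>Q\<close> with \<open>P = x Q\<close>; it is nonzero because injectivity allows only one
  zero root.\<close>

lemma prod_nonzero_roots_ge_1:
  fixes \<alpha> :: "nat \<Rightarrow> complex"
  assumes P: "map_poly of_int P = (\<Prod>j = 1..d. [:- \<alpha> j, 1:])"
    and "inj_on \<alpha> {1..d}" and z: "z \<in> {1..d}" "\<alpha> z = 0"
  shows "1 \<le> (\<Prod>j \<in> {1..d} - {z}. cmod (\<alpha> j))"
proof -
  have "real_of_int \<bar>poly.coeff P 0\<bar> = 0"
    using abs_coeff_0_prod_linear[OF P] z by (auto simp: prod_zero_iff)
  then obtain Q where Q: "P = pCons 0 Q"
    by (cases P) auto
  have "pCons 0 (map_poly of_int Q) = [:- \<alpha> z, 1:] * (\<Prod>j \<in> {1..d} - {z}. [:- \<alpha> j, 1:])"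
    using P prod.remove[of "{1..d}" z "\<lambda>j. [:- \<alpha> j, 1:]"] z
    by (simp add: Q of_int_hom.map_poly_pCons_hom)
  then have "map_poly of_int Q = (\<Prod>j \<in> {1..d} - {z}. [:- \<alpha> j, 1:])"
    by (simp add: z(2))
  then have eq: "real_of_int \<bar>poly.coeff Q 0\<bar> = (\<Prod>j \<in> {1..d} - {z}. cmod (\<alpha> j))"
    by (rule abs_coeff_0_prod_linear)
  have "\<alpha> j \<noteq> 0" if "j \<in> {1..d} - {z}" for j
    using inj_on_contraD[OF assms(2), of j z] that z by (simp only: Diff_iff singleton_iff) metis
  then have "(\<Prod>j \<in> {1..d} - {z}. cmod (\<alpha> j)) \<noteq> 0"
    by (simp only: prod_zero_iff finite_Diff finite_atLeastAtMost norm_eq_zero) blast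
  then have "1 \<le> \<bar>poly.coeff Q 0\<bar>"
    unfolding eq[symmetric] by auto
  then show ?thesis
    unfolding eq[symmetric] by simp
qed

section \<open>Comparison of the three quantities\<close>

text \<open>The exponent is -1 when \<open>m = d\<close>, hence \<open>powi\<close>. If 0 is a root
  and \<open>m < d - 1\<close>, the middle term is 0 while \<open>mahler_measure P ^ (d - 1)\<close>
  is at least 1, hence the guard; the last conjunct gives the outer inequality in every
  case.\<close>

theorem theorem6p3:
  fixes P :: "int poly" and \<alpha> :: "nat \<Rightarrow> complex" and d m :: nat
  assumes "d \<ge> 1" and "degree P = d" and "lead_coeff P = 1"
    and "map_poly of_int P = (\<Prod>j = 1..d. [:- \<alpha> j, 1:])"
    and "inj_on \<alpha> {1..d}"
    and "m = card {j \<in> {1..d}. cmod (\<alpha> j) > 1}"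
  shows "limsup (\<lambda>n. ereal (root n (cmod (discriminant (power_poly \<alpha> d n)))))
           \<ge> ereal (mahler_measure P ^ d * real_of_int \<bar>poly.coeff P 0\<bar> powi (int d - int m - 1))
       \<and> (poly.coeff P 0 \<noteq> 0 \<or> m = d - 1 \<longrightarrow>
           mahler_measure P ^ d * real_of_int \<bar>poly.coeff P 0\<bar> powi (int d - int m - 1)
             \<ge> mahler_measure P ^ (d - 1))
       \<and> limsup (\<lambda>n. ereal (root n (cmod (discriminant (power_poly \<alpha> d n)))))
           \<ge> ereal (mahler_measure P ^ (d - 1))"
proof -
  define a where "a j = cmod (\<alpha> j)" for j
  define S where "S = {j \<in> {1..d}. a j > 1}"
  define T where "T = {j \<in> {1..d}. a j \<le> 1}"
  define M where "M = mahler_measure P"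
  define L where "L = (\<Prod>k = 1..d. \<Prod>j = 1..<k. (max (a j) (a k))\<^sup>2)"
  define A where "A = real_of_int \<bar>poly.coeff P 0\<bar>"
  define E where "E = M ^ d * A powi (int d - int m - 1)"
  have ST: "{1..d} = S \<union> T" "S \<inter> T = {}" "finite S" "finite T"
    by (auto simp: S_def T_def)
  have m: "card S = m"
    by (simp add: S_def a_def assms(6))
  have d: "d = m + card T"
    using card_Un_disjoint[OF ST(3,4,2)] by (simp add: m flip: ST(1))
  have M: "M = prod a S"
    unfolding M_def S_def a_def by (rule mahler_measure_prod_linear[OF assms(4)])
  have "M \<ge> 1"
    unfolding M by (rule prod_ge_1) (simp add: S_def)
  \<comment> \<open>For \<open>m = 0\<close> the truncated \<open>m - 1\<close> makes the exponents
    differ, but then \<open>M\<close> is an empty product.\<close>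
  have Mpow: "M ^ (d - 1 + card T) = M ^ (m - 1 + 2 * card T)"
  proof (cases "m = 0")
    case True
    then have "M = 1"
      using M m ST by simp
    then show ?thesis
      by simp
  next
    case False
    then show ?thesis
      using d by (intro arg_cong[of _ _ "(^) M"]) simp
  qed
  have a: "a j \<ge> 0" for j
    by (simp add: a_def)
  have A: "A = M * prod a T"
    using abs_coeff_0_prod_linear[OF assms(4)] ST
    by (simp add: A_def M prod.union_disjoint flip: a_def)
  have limsup: "ereal L \<le> limsup (\<lambda>n. ereal (root n (cmod (discriminant (power_poly \<alpha> d n)))))"
  proof -
    obtain C where "C > 0" "\<exists>\<^sub>F n in sequentially. C * L ^ n
        \<le> cmod (\<Prod>k = 1..d. \<Prod>j = 1..<k. (\<alpha> j ^ n - \<alpha> k ^ n)\<^sup>2)"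
      using frequently_prod_power_diff_ge[OF assms(5)] unfolding L_def a_def by blast
    moreover have "L \<ge> 0"
      by (auto simp: L_def intro!: prod_nonneg)
    ultimately show ?thesis
      unfolding power_poly_def discriminant_prod_linear by (intro limsup_root_ge)
  qed
  \<comment> \<open>Here \<open>A = M\<close> and the exponent of \<open>A\<close> is -1.\<close>
  have E_eq: "E = M ^ (d - 1)" if "T = {}"
  proof -
    have "m = d"
      using d that by simp
    then show ?thesis
      using \<open>M \<ge> 1\<close> \<open>d \<ge> 1\<close> power_minus_mult[of d M]
      by (simp add: E_def A that power_int_minus field_simps)
  qed
  have E_le: "E \<le> L"
  proof (cases "card T = 0")
    case True
    then have "T = {}"
      using ST by simp
    then have "E = M ^ (d - 1)"
      by (rule E_eq)
    also have "\<dots> \<le> L"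
      using prod_max_ge[OF a S_def T_def] True \<open>T = {}\<close> d m
      by (simp add: L_def M)
    finally show ?thesis .
  next
    case False
    then have "int d - int m - 1 = int (card T - 1)"
      using d by simp
    then have "E = M ^ (d + (card T - 1)) * prod a T ^ (card T - 1)"
      by (simp only: E_def A power_int_of_nat power_mult_distrib power_add mult.assoc)
    also have "d + (card T - 1) = d - 1 + card T"
      using False \<open>d \<ge> 1\<close> by simp
    also have "M ^ \<dots> * prod a T ^ (card T - 1) \<le> L"
      using prod_max_ge[OF a S_def T_def] by (simp only: Mpow L_def m flip: M)
    finally show ?thesis .
  qed
  have ge: "M ^ (d - 1) \<le> E" if "A \<noteq> 0 \<or> m = d - 1"
  proof (cases "card T = 0")
    case True
    then have "T = {}"
      using ST by simp
    then show ?thesis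
      by (simp add: E_eq)
  next
    case False
    then have *: "int d - int m - 1 = int (card T - 1)"
      using d by simp
    \<comment> \<open>If \<open>A = 0\<close>, then \<open>m = d - 1\<close> and the power is
      \<open>0 ^ 0 = 1\<close>; otherwise \<open>A\<close> is a positive integer.\<close>
    have "1 \<le> A ^ (card T - 1)"
    proof (cases "A = 0")
      case True
      then show ?thesis
        using that d \<open>d \<ge> 1\<close> by auto
    next
      case False
      then have "A \<ge> 1"
        by (auto simp: A_def)
      then show ?thesis
        by simp
    qed
    moreover have "M ^ (d - 1) \<le> M ^ d"
      using \<open>M \<ge> 1\<close> by (intro power_increasing) auto
    ultimately have "M ^ (d - 1) * 1 \<le> M ^ d * A ^ (card T - 1)"
      using \<open>M \<ge> 1\<close> by (intro mult_mono) auto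
    then show ?thesis
      by (simp only: E_def * power_int_of_nat)
  qed
  have "M ^ (d - 1) \<le> L"
  proof (cases "A = 0")
    case False
    then show ?thesis
      using ge E_le by linarith
  next
    case True
    then obtain z where z: "z \<in> T" "a z = 0"
      using A \<open>M \<ge> 1\<close> ST by auto
    define B where "B = prod a (T - {z})"
    have "\<alpha> z = 0"
      using z(2) by (simp add: a_def)
    have z': "z \<in> {1..d}"
      using z ST by blast
    then have "{1..d} - {z} = S \<union> (T - {z})" "S \<inter> (T - {z}) = {}"
      using z ST by auto
    then have "1 \<le> M * B"
      using prod_nonzero_roots_ge_1[OF assms(4,5) z' \<open>\<alpha> z = 0\<close>] ST
      by (simp add: M B_def prod.union_disjoint flip: a_def)
    \<comment> \<open>\<open>M * B\<close> is the product of the moduli of the nonzero roots; its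
      power \<open>card T\<close> supplies exactly the exponents of
      \<open>prod_max_ge_zero\<close>.\<close>
    then have "M ^ (d - 1) * 1 \<le> M ^ (d - 1) * (M * B) ^ card T"
      using \<open>M \<ge> 1\<close> by (intro mult_left_mono) auto
    also have "\<dots> = M ^ (d - 1 + card T) * B ^ card T"
      by (simp add: power_add power_mult_distrib)
    also have "\<dots> \<le> L"
      using prod_max_ge_zero[OF a S_def T_def z' z(2)]
      by (simp only: Mpow L_def m B_def flip: M)
    finally show ?thesis
      by simp
  qed
  then have "ereal (M ^ (d - 1)) \<le> limsup (\<lambda>n. ereal (root n (cmod (discriminant (power_poly \<alpha> d n)))))"
    by (intro order_trans[OF _ limsup]) simp
  moreover have "ereal E \<le> limsup (\<lambda>n. ereal (root n (cmod (discriminant (power_poly \<alpha> d n)))))"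
    using E_le by (intro order_trans[OF _ limsup]) simp
  moreover have "M ^ (d - 1) \<le> E" if "poly.coeff P 0 \<noteq> 0 \<or> m = d - 1"
    using that by (intro ge) (simp add: A_def)
  ultimately show ?thesis
    unfolding M_def A_def E_def by blast
qed

end
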